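(* Let $u$ be a positive integer, let $i\ge 1$ be an integer, and let $k$ be an even integer with $4\le k\le 2i$. Let $q=\left\lfloor uP_{2i+1}(u)/P_k(u)\right\rfloor$ and $r=P_{2i+1}(u)-q\,\bigl(P_k(u)/u\bigr)$. Let $p$ be an integer with $0\le p\le q$. If $u\,r\,P_{2i}(u)>\bigl(P_{k-2}(u)/u-(u^2+1)r\bigr)P_{2i+1}(u)$, then $$g_p\bigl(P_{2i+1}(u),P_{2i+3}(u),P_{2i+k+1}(u)\bigr)=(r-1)P_{2i+3}(u)+(q+p)P_{2i+k+1}(u)-P_{2i+1}(u).$$ Otherwise, $$g_p\bigl(P_{2i+1}(u),P_{2i+3}(u),P_{2i+k+1}(u)\bigr)=\left(\frac{P_k(u)}{u}-1\right)P_{2i+3}(u)+(q+p-1)P_{2i+k+1}(u)-P_{2i+1}(u).$$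
   Context: For a fixed positive integer $u$, the Pell-type numbers $P_n(u)$ are defined by $P_0(u)=0$, $P_1(u)=1$ and $P_n(u)=uP_{n-1}(u)+P_{n-2}(u)$ for $n\ge 2$. (Then $u\mid P_{2n}(u)$ for all $n$.) Let $A=\{a_1,\dots,a_\kappa\}$ be a set of positive integers with $\gcd(a_1,\dots,a_\kappa)=1$ and let $p$ be a nonnegative integer. $S_p(A)$ is the set of integers $n$ for which there are more than $p$ tuples $(x_1,\dots,x_\kappa)$ of nonnegative integers with $n=x_1a_1+\cdots+x_\kappa a_\kappa$. The set $\mathbb{N}_0\setminus S_p(A)$, with $\mathbb{N}_0=\{0,1,2,\dots\}$, is finite; the $p$-Frobenius number $g_p(A)=g_p(a_1,\dots,a_\kappa)$ is its largest element. *)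

theory Defs
  imports Main "HOL-Library.FuncSet"
begin

fun pell :: "nat \<Rightarrow> nat \<Rightarrow> nat" where
  "pell u 0 = 0"
| "pell u (Suc 0) = 1"
| "pell u (Suc (Suc n)) = u * pell u (Suc n) + pell u n"

(* Consequently pell u k div u is an exact quotient for even k. *)
lemma dvd_pell_even: "u dvd pell u (2 * n)"
  by (induction n) simp_all

(* A tuple of coefficients is a function on A; extensionality makes the
   coefficient vectors countable by card.  If every element of A is positive,
   there are only finitely many of them for each n. *)
definition representations :: "nat set \<Rightarrow> nat \<Rightarrow> (nat \<Rightarrow> nat) set" where
  "representations A n = {x \<in> A \<rightarrow>\<^sub>E UNIV. (\<Sum>a\<in>A. x a * a) = n}"

(* Negative integers have no representation, so it suffices to collect natural numbers. *)
definition p_semigroup :: "nat \<Rightarrow> nat set \<Rightarrow> nat set" where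
  "p_semigroup p A = {n. card (representations A n) > p}"

(* Meaningful when A is finite, all its elements are positive, Gcd A = 1, and
   the set of gaps is nonempty (it is empty only for p = 0 and 1 \<in> A). *)
definition p_frobenius :: "nat \<Rightarrow> nat set \<Rightarrow> nat" where
  "p_frobenius p A = Max (UNIV - p_semigroup p A)"

end

theory Submission
  imports Defs "HOL-Number_Theory.Cong"
begin

text \<open>
  Write \<open>a\<close>, \<open>b\<close>, \<open>c\<close> for the three generators, \<open>m = P\<^sub>k / u\<close> and \<open>m' = P\<^sub>k\<^sub>-\<^sub>2 / u\<close>.
  Then \<open>c = m b - m' a\<close> and \<open>a = q m + r\<close>, so the residue of \<open>y b + z c\<close> modulo \<open>a\<close> is
  determined by \<open>y + m z\<close>, and the pairs \<open>(y, z)\<close> in a fixed residue class form a coset of the lattice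
  spanned by \<open>(m, -1)\<close> and \<open>(r, q)\<close>, along which \<open>y b + z c\<close> changes by \<open>m' a\<close> and
  \<open>(b - q m') a\<close>. Every class has exactly one pair in the L-shaped region of the pairs
  with \<open>y < m\<close>, \<open>z < q\<close> or \<open>y < r\<close>, \<open>z = q\<close>. Starting from this pair \<open>p + 1\<close> nonnegative pairs
  are written down whose values are at most that of \<open>(r - 1, q + p)\<close> or that of
  \<open>(m - 1, q + p - 1)\<close>. Conversely, the nonnegative pairs in the class of either of these two
  extreme pairs that have a strictly smaller value all lie on one line of the coset, with
  \<open>z < p\<close>, so there are at most \<open>p\<close> of them. Hence the larger of the two values, minus \<open>a\<close>, is
  the \<open>p\<close>-Frobenius number.
\<close>

section \<open>Representations by three generators as coefficient triples\<close>

definition triple_representations :: "nat \<Rightarrow> nat \<Rightarrow> nat \<Rightarrow> nat \<Rightarrow> (nat \<times> nat \<times> nat) set" where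
  "triple_representations a b c n = {(x, y, z). x * a + y * b + z * c = n}"

lemma card_representations_triple:
  assumes "a \<noteq> b" "b \<noteq> c" "a \<noteq> c"
  shows "card (representations {a, b, c} n) = card (triple_representations a b c n)"
proof -
  let ?f = "\<lambda>g :: nat \<Rightarrow> nat. (g a, g b, g c)"
  have "bij_betw ?f (representations {a, b, c} n) (triple_representations a b c n)"
    unfolding bij_betw_def
  proof (intro conjI equalityI subsetI)
    show "inj_on ?f (representations {a, b, c} n)"
    proof (rule inj_onI)
      fix g h assume "g \<in> representations {a, b, c} n" "h \<in> representations {a, b, c} n"
      then have "g \<in> {a, b, c} \<rightarrow>\<^sub>E UNIV" "h \<in> {a, b, c} \<rightarrow>\<^sub>E UNIV"
        by (simp_all add: representations_def)
      moreover assume "?f g = ?f h"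
      then have "g v = h v" if "v \<in> {a, b, c}" for v
        using that by auto
      ultimately show "g = h"
        by (rule PiE_ext)
    qed
  next
    fix t assume "t \<in> ?f ` representations {a, b, c} n"
    then show "t \<in> triple_representations a b c n"
      using assms by (auto simp: representations_def triple_representations_def)
  next
    fix t assume "t \<in> triple_representations a b c n"
    then obtain x y z where t: "t = (x, y, z)" "x * a + y * b + z * c = n"
      by (auto simp: triple_representations_def)
    define g where "g = (\<lambda>v\<in>{a, b, c}. if v = a then x else if v = b then y else z)"
    have g: "g \<in> representations {a, b, c} n"
      using assms t by (auto simp: representations_def g_def)
    have "t = ?f g"
      using assms t by (auto simp: g_def)
    then show "t \<in> ?f ` representations {a, b, c} n"
      using g by (rule image_eqI)
  qed
  then show ?thesis
    by (rule bij_betw_same_card)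
qed

lemma finite_triple_representations:
  assumes "a > 0" "b > 0" "c > 0"
  shows "finite (triple_representations a b c n)"
proof (rule finite_subset)
  show "triple_representations a b c n \<subseteq> {..n} \<times> {..n} \<times> {..n}"
  proof
    fix t assume "t \<in> triple_representations a b c n"
    then obtain x y z where t: "t = (x, y, z)" "x * a + y * b + z * c = n"
      by (auto simp: triple_representations_def)
    have "x \<le> x * a" "y \<le> y * b" "z \<le> z * c"
      using assms by auto
    then have "x \<le> n" "y \<le> n" "z \<le> n"
      using t(2) by linarith+
    with t(1) show "t \<in> {..n} \<times> {..n} \<times> {..n}"
      by simp
  qed
qed auto

text \<open>The second assumption also bounds the set of gaps, so it is finite and
  \<open>Max\<close> is meaningful.\<close>

lemma p_frobenius_eqI:
  assumes "card (representations A N) \<le> p"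
    and "\<And>n. n > N \<Longrightarrow> card (representations A n) > p"
  shows "p_frobenius p A = N"
proof -
  have le: "n \<le> N" if "n \<in> UNIV - p_semigroup p A" for n
    using that assms(2)[of n] by (cases "n \<le> N") (auto simp: p_semigroup_def)
  then have "finite (UNIV - p_semigroup p A)"
    by (meson finite_nat_set_iff_bounded_le)
  moreover have "N \<in> UNIV - p_semigroup p A"
    using assms(1) by (simp add: p_semigroup_def)
  ultimately show ?thesis
    unfolding p_frobenius_def using le by (intro Max_eqI) auto
qed

subsection \<open>Three generators with an L-shaped Ap\'ery set\<close>

text \<open>\<open>b_ge\<close> says that the lattice step \<open>(r - m, q + 1)\<close> never
  lowers the value \<open>y b + z c\<close>; \<open>m'_a\<close> says that a step
  \<open>(m, -1)\<close> raises it by at most \<open>c\<close>.\<close>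

locale L_shape =
  fixes a b c m m' q r :: nat
  assumes a_pos: "a > 0" and ab: "a < b" and bc: "b < c"
    and cop: "coprime a b"
    and c_eq: "m * b = c + m' * a"
    and a_eq: "a = q * m + r" and r_less: "r < m"
    and q_pos: "q > 0" and m_ge: "m \<ge> 2"
    and b_ge: "(q + 1) * m' \<le> b"
    and m'_a: "m' * a \<le> c"
begin

lemma c_int: "int c = int m * int b - int m' * int a"
  using arg_cong[OF c_eq, of int] by simp

lemma a_int: "int a = int q * int m + int r"
  using a_eq by simp

text \<open>Substituting \<open>c_int\<close> and cancelling \<open>b\<close> modulo
  \<open>a\<close> shows that \<open>a\<close> divides \<open>(y - y0) + m (z - z0)\<close>. The
  quotient is \<beta>, and the change of \<open>z\<close> then forces \<alpha>.\<close>

lemma lattice_coords: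
  fixes y z y0 z0 x :: int
  assumes "x * int a + y * int b + z * int c = y0 * int b + z0 * int c"
  obtains \<alpha> \<beta> where "y = y0 + \<alpha> * int m + \<beta> * int r" "z = z0 - \<alpha> + \<beta> * int q"
    "- x = \<alpha> * int m' + \<beta> * (int b - int q * int m')"
proof -
  have e: "((y - y0) + int m * (z - z0)) * int b = int a * (int m' * (z - z0) - x)"
    using assms unfolding c_int by (simp add: algebra_simps)
  moreover have "coprime (int a) (int b)"
    using cop by simp
  ultimately have "int a dvd (y - y0) + int m * (z - z0)"
    by (metis coprime_dvd_mult_left_iff dvd_triv_left)
  then obtain \<beta> where \<beta>: "(y - y0) + int m * (z - z0) = int a * \<beta>" ..
  with e have "int a * (\<beta> * int b) = int a * (int m' * (z - z0) - x)"
    by (simp add: ac_simps)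
  then have \<beta>': "\<beta> * int b = int m' * (z - z0) - x"
    using a_pos by simp
  show thesis
  proof (rule that[of "z0 - z + \<beta> * int q" \<beta>])
    have "y = y0 + int a * \<beta> - int m * (z - z0)"
      using \<beta> by linarith
    then show "y = y0 + (z0 - z + \<beta> * int q) * int m + \<beta> * int r"
      by (simp add: a_int algebra_simps)
    show "- x = (z0 - z + \<beta> * int q) * int m' + \<beta> * (int b - int q * int m')"
      using \<beta>' by (simp add: algebra_simps)
  qed simp
qed

lemma few_representations:
  fixes y0 z0 :: int
  assumes N: "int N = y0 * int b + z0 * int c - int a" and "p \<le> q"
    and base: "y0 = int r - 1 \<and> z0 = int q + int p \<or> y0 = int m - 1 \<and> z0 = int q + int p - 1"
  shows "card (representations {a, b, c} N) \<le> p"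
proof -
  have y0: "y0 \<le> int m - 1" and z0: "z0 \<le> int q + int p"
    using base r_less by auto
  have key: "z < p \<and> int y = y0 + int m * z0 - int a - int m * int z" if t: "x * a + y * b + z * c = N" for x y z
  proof -
    \<comment> \<open>The extra 1 absorbs the \<open>- a\<close> in \<open>N\<close>: the pair
      \<open>(y, z)\<close> has value strictly below that of \<open>(y0, z0)\<close>.\<close>
    have "(int x + 1) * int a + int y * int b + int z * int c = y0 * int b + z0 * int c"
      using arg_cong[OF t, of int] N by (simp add: algebra_simps)
    then obtain \<alpha> \<beta> where y: "int y = y0 + \<alpha> * int m + \<beta> * int r" and z: "int z = z0 - \<alpha> + \<beta> * int q"
      and x: "- (int x + 1) = \<alpha> * int m' + \<beta> * (int b - int q * int m')"
      by (rule lattice_coords)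
    have y_nonneg: "y0 + \<alpha> * int m + \<beta> * int r \<ge> 0" and z_nonneg: "z0 - \<alpha> + \<beta> * int q \<ge> 0"
      using y z by linarith+
    have neg: "\<alpha> * int m' + \<beta> * (int b - int q * int m') < 0"
      using x by linarith
    \<comment> \<open>Here \<open>y \<ge> 0\<close> forces \<alpha> \<ge> -\<beta>, so by
      \<open>b_ge\<close> the value could not decrease.\<close>
    have "\<not> \<beta> \<ge> 0"
    proof
      assume \<beta>: "\<beta> \<ge> 0"
      have "\<beta> * int r \<le> \<beta> * (int m - 1)"
        using \<beta> r_less by (intro mult_left_mono) auto
      then have "0 \<le> (\<alpha> + \<beta> + 1) * int m - 1"
        using y_nonneg y0 \<beta> by (simp add: algebra_simps)
      then have "0 < (\<alpha> + \<beta> + 1) * int m"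
        by linarith
      then have "0 \<le> \<alpha> + \<beta>"
        by (simp add: zero_less_mult_iff)
      then have "0 \<le> (\<alpha> + \<beta>) * int m'"
        by simp
      moreover have "0 \<le> int b - (int q + 1) * int m'"
        using b_ge[folded of_nat_le_iff[where ?'a = int]] by (simp add: algebra_simps)
      then have "0 \<le> \<beta> * (int b - (int q + 1) * int m')"
        using \<beta> by simp
      ultimately show False
        using neg by (simp add: algebra_simps)
    qed
    \<comment> \<open>Here \<open>z \<ge> 0\<close> and \<open>p \<le> q\<close> push \<alpha> so
      low that \<open>y\<close> becomes negative.\<close>
    moreover have "\<not> \<beta> \<le> -2"
    proof
      assume \<beta>: "\<beta> \<le> -2"
      have bq: "\<beta> * int q \<le> -2 * int q"
        using \<beta> by (intro mult_right_mono) auto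
      have br: "\<beta> * int r \<le> -2 * int r"
        using \<beta> by (intro mult_right_mono) auto
      from base show False
      proof (elim disjE conjE)
        assume b: "y0 = int r - 1" "z0 = int q + int p"
        then have "\<alpha> \<le> 0"
          using z_nonneg bq \<open>p \<le> q\<close> by linarith
        then have "\<alpha> * int m \<le> 0"
          by (simp add: mult_nonpos_nonneg)
        then show False
          using y_nonneg b br by linarith
      next
        assume b: "y0 = int m - 1" "z0 = int q + int p - 1"
        then have "\<alpha> \<le> -1"
          using z_nonneg bq \<open>p \<le> q\<close> by linarith
        then have "\<alpha> * int m \<le> -1 * int m"
          by (intro mult_right_mono) auto
        then show False
          using y_nonneg b br by linarith
      qed
    qed
    ultimately have \<beta>: "\<beta> = -1"
      by linarith
    have "z < p"
      using base
    proof (elim disjE conjE)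
      assume b: "y0 = int r - 1" "z0 = int q + int p"
      have "0 < \<alpha> * int m"
        using y_nonneg \<beta> b by simp
      then have "0 < \<alpha>"
        by (simp add: zero_less_mult_iff)
      then show ?thesis
        using z \<beta> b by simp
    next
      assume b: "y0 = int m - 1" "z0 = int q + int p - 1"
      have "0 < (\<alpha> + 1) * int m"
        using y_nonneg \<beta> b by (simp add: algebra_simps)
      then have "0 \<le> \<alpha>"
        by (simp add: zero_less_mult_iff)
      then show ?thesis
        using z \<beta> b by simp
    qed
    moreover have "int y = y0 + int m * z0 - int a - int m * int z"
      unfolding y z \<beta> a_int by (simp add: algebra_simps)
    ultimately show ?thesis
      by blast
  qed
  let ?T = "triple_representations a b c N"
  \<comment> \<open>On the single remaining line, \<open>z\<close> determines \<open>y\<close>, and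
    then \<open>N\<close> determines \<open>x\<close>.\<close>
  have "inj_on (\<lambda>(x, y, z). z) ?T"
  proof (rule inj_onI)
    fix s t assume "s \<in> ?T" "t \<in> ?T" and eq: "(\<lambda>(x, y, z). z) s = (\<lambda>(x, y, z). z) t"
    then obtain x y z x' y' z' where st: "s = (x, y, z)" "t = (x', y', z')"
      and s: "x * a + y * b + z * c = N" and t: "x' * a + y' * b + z' * c = N"
      by (auto simp: triple_representations_def)
    from eq st have z: "z' = z"
      by simp
    with key[OF s] key[OF t] have y: "y' = y"
      by simp
    have "x' * a = x * a"
      using s t unfolding y z by linarith
    with a_pos y z st show "s = t"
      by simp
  qed
  moreover have "(\<lambda>(x, y, z). z) ` ?T \<subseteq> {..<p}"
    using key by (auto simp: triple_representations_def)
  ultimately have "card ?T \<le> card {..<p}"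
    by (rule card_inj_on_le) simp
  then show ?thesis
    using card_representations_triple[of a b c N] ab bc by simp
qed

text \<open>From \<open>(y1, z1)\<close> in the class of \<open>n\<close>, \<open>l\<close> steps
  along \<open>(m, -1)\<close> give a pair of value at most \<open>y1 b + (z1 + l) c\<close>. By
  \<open>bound\<close> this is at most the value of an extreme pair, hence below
  \<open>n + a\<close>; multiples of \<open>a\<close> fill the gap to \<open>n\<close>.\<close>

lemma ex_representation:
  assumes n: "[t * b = n] (mod a)" and yz: "int a dvd int y1 + int m * int z1 - int t" and "l \<le> z1"
    and bound: "y1 < r \<and> z1 + l \<le> q + p \<or> y1 < m \<and> z1 + l < q + p"
    and X: "(int r - 1) * int b + (int q + int p) * int c - int a < int n"
    and Y: "(int m - 1) * int b + (int q + int p - 1) * int c - int a < int n"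
  shows "\<exists>x y. x * a + y * b + (z1 - l) * c = n"
proof -
  define v where "v = int (y1 + l * m) * int b + int (z1 - l) * int c"
  have v: "v = int y1 * int b + int z1 * int c + int l * (int m' * int a)"
    using \<open>l \<le> z1\<close> by (simp add: v_def of_nat_diff c_int algebra_simps)
  have "int l * (int m' * int a) \<le> int l * int c"
    using m'_a by (intro mult_left_mono) (simp_all flip: of_nat_mult)
  then have v_le: "v \<le> int y1 * int b + (int z1 + int l) * int c"
    by (simp add: v algebra_simps)
  have "v - int a < int n"
    using bound
  proof (elim disjE conjE)
    assume "y1 < r" "z1 + l \<le> q + p"
    then have "int y1 * int b \<le> (int r - 1) * int b" "(int z1 + int l) * int c \<le> (int q + int p) * int c"
      by (intro mult_right_mono; simp)+
    with v_le X show ?thesis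
      by linarith
  next
    assume "y1 < m" "z1 + l < q + p"
    then have "int y1 * int b \<le> (int m - 1) * int b" "(int z1 + int l) * int c \<le> (int q + int p - 1) * int c"
      by (intro mult_right_mono; simp)+
    with v_le Y show ?thesis
      by linarith
  qed
  moreover have "int a dvd int n - v"
  proof -
    have "int a dvd int t * int b - int n"
      using n by (simp add: cong_iff_dvd_diff flip: cong_int_iff)
    moreover have "int n - v = - (int t * int b - int n) - (int y1 + int m * int z1 - int t) * int b
        + int a * (int z1 * int m' - int l * int m')"
      by (simp add: v c_int algebra_simps)
    ultimately show ?thesis
      using yz by (simp only: dvd_add dvd_diff dvd_minus_iff dvd_mult2 dvd_triv_left)
  qed
  then obtain x where x: "int n - v = int a * x" ..
  \<comment> \<open>A multiple of \<open>a\<close> exceeding \<open>-a\<close> is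
    nonnegative.\<close>
  ultimately have "0 < int a * (x + 1)"
    by (simp add: algebra_simps)
  then have "0 \<le> x"
    by (simp add: zero_less_mult_iff)
  then obtain x' where "x = int x'"
    using nonneg_int_cases by blast
  then have "int (x' * a + (y1 + l * m) * b + (z1 - l) * c) = int n"
    using x by (simp add: v_def ac_simps distrib_left)
  then show ?thesis
    by (metis of_nat_eq_iff)
qed

lemma many_representations:
  assumes "p \<le> q"
    and X: "(int r - 1) * int b + (int q + int p) * int c - int a < int n"
    and Y: "(int m - 1) * int b + (int q + int p - 1) * int c - int a < int n"
  shows "p < card (representations {a, b, c} n)"
proof -
  obtain b' where "[b * b' = 1] (mod a)"
    using cong_solve_coprime_nat[of b a] cop by (auto simp: ac_simps)
  then have "[b * b' * n = 1 * n] (mod a)"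
    by (rule cong_scalar_right)
  then have "[b' * n mod a * b = n] (mod a)"
    by (simp add: cong_def mod_mult_right_eq ac_simps)
  then obtain t where t: "t < a" "[t * b = n] (mod a)"
    using a_pos mod_less_divisor by blast
  \<comment> \<open>Division with remainder by \<open>m\<close> yields the pair of this class in the
    L-shaped region, since \<open>t < a = q m + r\<close>.\<close>
  define y0 where "y0 = t mod m"
  define z0 where "z0 = t div m"
  have t_eq: "t = y0 + m * z0"
    by (simp add: y0_def z0_def)
  have y0: "y0 < m"
    using m_ge by (simp add: y0_def)
  have "z0 * m < (q + 1) * m"
    using t(1) t_eq a_eq r_less by (simp add: ac_simps)
  then have z0: "z0 \<le> q"
    unfolding mult_less_cancel2 by simp
  have y0_r: "y0 < r" if "z0 = q"
    using t(1) t_eq that a_eq by simp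
  \<comment> \<open>The \<open>z\<close>-coordinate of the \<open>j\<close>-th pair: go from \<open>(y0, z0)\<close> along \<open>(m, -1)\<close> while \<open>z \<ge> 0\<close>; then
    restart from \<open>(y0 + r, z0 + q)\<close>, or from \<open>(y0 + r - m, z0 + q + 1)\<close> if \<open>y0 + r \<ge> m\<close>.\<close>
  define \<zeta> where "\<zeta> j = (if j \<le> z0 then z0 - j
    else if y0 + r < m then 2 * z0 + q + 1 - j else 2 * z0 + q + 2 - j)" for j
  let ?T = "triple_representations a b c n"
  have "\<exists>x y. x * a + y * b + \<zeta> j * c = n" if j: "j \<le> p" for j
  proof -
    consider "j \<le> z0" | "z0 < j" "y0 + r < m" | "z0 < j" "m \<le> y0 + r"
      by linarith
    then show ?thesis
    proof cases
      case 1
      \<comment> \<open>The tip \<open>z0 = q\<close> of the L is compared with the first extreme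
        pair, everything below it with the second.\<close>
      have "y0 < r \<and> z0 + j \<le> q + p \<or> y0 < m \<and> z0 + j < q + p"
        using y0_r y0 z0 j by (cases "z0 = q") auto
      then have "\<exists>x y. x * a + y * b + (z0 - j) * c = n"
        using 1 by (intro ex_representation[where ?y1.0 = y0, OF t(2) _ _ _ X Y]) (auto simp: t_eq)
      then show ?thesis
        using 1 by (simp add: \<zeta>_def)
    next
      case 2
      \<comment> \<open>The first line used the indices \<open>0..z0\<close>, so
        \<open>j - z0 - 1\<close> steps have been made on the new one, and
        \<open>z1 + l = q + j - 1 < q + p\<close>.\<close>
      have "\<exists>x y. x * a + y * b + (z0 + q - (j - z0 - 1)) * c = n"
      proof (rule ex_representation[where ?y1.0 = "y0 + r", OF t(2) _ _ _ X Y])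
        have "int (y0 + r) + int m * int (z0 + q) - int t = int a"
          by (simp add: t_eq a_int algebra_simps)
        then show "int a dvd int (y0 + r) + int m * int (z0 + q) - int t"
          by simp
      qed (use 2 j \<open>p \<le> q\<close> in linarith)+
      moreover have "\<zeta> j = z0 + q - (j - z0 - 1)"
        using 2 j \<open>p \<le> q\<close> by (simp add: \<zeta>_def)
      ultimately show ?thesis
        by simp
    next
      case 3
      \<comment> \<open>Now \<open>z1 + l = q + j\<close> may reach \<open>q + p\<close>, but
        \<open>y0 + r - m < r\<close>, which is the first alternative of
        \<open>bound\<close>.\<close>
      have "\<exists>x y. x * a + y * b + (z0 + q + 1 - (j - z0 - 1)) * c = n"
      proof (rule ex_representation[where ?y1.0 = "y0 + r - m", OF t(2) _ _ _ X Y])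
        have "int (y0 + r - m) + int m * int (z0 + q + 1) - int t = int a"
          using 3 by (simp add: t_eq a_int of_nat_diff algebra_simps)
        then show "int a dvd int (y0 + r - m) + int m * int (z0 + q + 1) - int t"
          by simp
      qed (use 3 j \<open>p \<le> q\<close> y0 in linarith)+
      moreover have "\<zeta> j = z0 + q + 1 - (j - z0 - 1)"
        using 3 j \<open>p \<le> q\<close> by (simp add: \<zeta>_def)
      ultimately show ?thesis
        by simp
    qed
  qed
  then have "\<zeta> ` {..p} \<subseteq> (\<lambda>(x, y, z). z) ` ?T"
    by (force simp: triple_representations_def)
  moreover have "finite ?T"
    using a_pos ab bc by (intro finite_triple_representations) auto
  ultimately have "card (\<zeta> ` {..p}) \<le> card ?T"
    by (rule surj_card_le[rotated])
  \<comment> \<open>As \<open>p \<le> q\<close>, the second line stays above \<open>z0\<close>, so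
    it repeats no value of the first.\<close>
  moreover have "inj_on \<zeta> {..p}"
    using \<open>p \<le> q\<close> unfolding inj_on_def \<zeta>_def by auto
  then have "card (\<zeta> ` {..p}) = p + 1"
    by (simp add: card_image)
  ultimately show ?thesis
    using card_representations_triple[of a b c n] ab bc by simp
qed

theorem p_frobenius_L_shape:
  assumes "p \<le> q"
  shows "int (p_frobenius p {a, b, c}) =
    (if m' * a < r * b then (int r - 1) * int b + (int q + int p) * int c - int a
     else (int m - 1) * int b + (int q + int p - 1) * int c - int a)"
proof -
  define X where "X = (int r - 1) * int b + (int q + int p) * int c - int a"
  define Y where "Y = (int m - 1) * int b + (int q + int p - 1) * int c - int a"
  define M where "M = (if m' * a < r * b then X else Y)"
  have "X - Y = int (r * b) - int (m' * a)"
    by (simp add: X_def Y_def c_int algebra_simps)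
  then have M: "X \<le> M" "Y \<le> M"
    unfolding M_def by (auto simp del: of_nat_mult)
  have "1 * int b \<le> (int m - 1) * int b" "0 \<le> (int q + int p - 1) * int c"
    using m_ge q_pos by (intro mult_right_mono mult_nonneg_nonneg; simp)+
  then have "0 \<le> Y"
    using ab unfolding Y_def by linarith
  with M have "0 \<le> M"
    by linarith
  have "p_frobenius p {a, b, c} = nat M"
  proof (rule p_frobenius_eqI)
    show "card (representations {a, b, c} (nat M)) \<le> p"
    proof (cases "m' * a < r * b")
      case True
      then show ?thesis
        using \<open>0 \<le> M\<close> assms
        by (intro few_representations[where ?y0.0 = "int r - 1" and ?z0.0 = "int q + int p"])
          (simp_all add: M_def X_def)
    next
      case False
      then show ?thesis
        using \<open>0 \<le> M\<close> assms
        by (intro few_representations[where ?y0.0 = "int m - 1" and ?z0.0 = "int q + int p - 1"])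
          (simp_all add: M_def Y_def)
    qed
  next
    fix n assume "nat M < n"
    then show "p < card (representations {a, b, c} n)"
      using M assms by (intro many_representations) (simp_all flip: X_def Y_def)
  qed
  then show ?thesis
    using \<open>0 \<le> M\<close> by (simp add: M_def X_def Y_def)
qed

end

subsection \<open>Pell-type numbers\<close>

lemma pell_add_4: "pell u (n + 4) + pell u n = (u\<^sup>2 + 2) * pell u (n + 2)"
  by (simp add: numeral_eq_Suc algebra_simps)

text \<open>This is the source of \<open>c = m b - m' a\<close>, up to a factor \<open>u\<close>.
  The induction works because both factors on the right obey the same two-step recurrence
  \<open>pell_add_4\<close>.\<close>

lemma pell_even_shift:
  "u * pell u (n + 2 * Suc h) + pell u (2 * h) * pell u n = pell u (2 * Suc h) * pell u (n + 2)"
proof (induction h arbitrary: n)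
  case 0
  show ?case
    by (simp add: numeral_eq_Suc)
next
  case (Suc h)
  have "n + 2 + 2 * Suc h = n + 2 * Suc (Suc h)" "n + 2 + 2 = n + 4"
    by simp_all
  then have "u * pell u (n + 2 * Suc (Suc h)) + pell u (2 * h) * pell u (n + 2)
      = pell u (2 * Suc h) * pell u (n + 4)"
    using Suc.IH[of "n + 2"] by (simp only:)
  moreover have "pell u (2 * Suc h) * (pell u (n + 4) + pell u n)
      = (pell u (2 * Suc (Suc h)) + pell u (2 * h)) * pell u (n + 2)"
  proof -
    have "2 * Suc h = 2 * h + 2" "2 * Suc (Suc h) = 2 * h + 4"
      by simp_all
    then have "pell u (2 * Suc (Suc h)) + pell u (2 * h) = (u\<^sup>2 + 2) * pell u (2 * Suc h)"
      using pell_add_4[of u "2 * h"] by (simp only:)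
    then show ?thesis
      unfolding pell_add_4 by (simp only: mult.commute mult.left_commute)
  qed
  ultimately show ?case
    unfolding distrib_left distrib_right by linarith
qed

lemma pell_mono:
  assumes "u > 0" "m \<le> n"
  shows "pell u m \<le> pell u n"
proof (rule lift_Suc_mono_le[OF _ assms(2)])
  show "pell u n \<le> pell u (Suc n)" for n
    using assms(1) by (cases n) (auto intro: trans_le_add1)
qed

lemma pell_double_le:
  assumes "u > 0"
  shows "2 * pell u n \<le> pell u (n + 2)"
proof -
  have "pell u n \<le> pell u (Suc n)"
    using assms by (intro pell_mono) auto
  also have "\<dots> \<le> u * pell u (Suc n)"
    using assms by simp
  finally show ?thesis
    by simp
qed

lemma coprime_pell_Suc: "coprime (pell u n) (pell u (Suc n))"
proof (induction n)
  case (Suc n)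
  then show ?case
    by (simp add: coprime_iff_gcd_eq_1 gcd.commute gcd_add_mult)
qed simp

lemma coprime_pell_odd: "coprime u (pell u (2 * n + 1))"
proof (induction n)
  case (Suc n)
  have "pell u (2 * Suc n + 1) = pell u (2 * Suc n) * u + pell u (2 * n + 1)"
    by simp
  with Suc show ?case
    by (simp only: coprime_iff_gcd_eq_1 gcd_add_mult)
qed simp

section \<open>The Pell triple as an instance of the L-shape\<close>

theorem theorem4:
  fixes u i k p q :: nat and r :: int
  assumes "u > 0" and "i \<ge> 1" and "even k" and "4 \<le> k" and "k \<le> 2 * i"
    and q_def: "q = (u * pell u (2 * i + 1)) div pell u k"
    and r_def: "r = int (pell u (2 * i + 1)) - int q * int (pell u k div u)"
    and "p \<le> q"
  shows "int (p_frobenius p {pell u (2 * i + 1), pell u (2 * i + 3), pell u (2 * i + k + 1)}) =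
    (if int u * r * int (pell u (2 * i))
          > (int (pell u (k - 2) div u) - (int u ^ 2 + 1) * r) * int (pell u (2 * i + 1))
     then (r - 1) * int (pell u (2 * i + 3)) + (int q + int p) * int (pell u (2 * i + k + 1))
            - int (pell u (2 * i + 1))
     else (int (pell u k div u) - 1) * int (pell u (2 * i + 3))
            + (int q + int p - 1) * int (pell u (2 * i + k + 1))
            - int (pell u (2 * i + 1)))"
proof -
  define a b c where "a = pell u (2 * i + 1)" and "b = pell u (2 * i + 3)"
    and "c = pell u (2 * i + k + 1)"
  define m m' where "m = pell u k div u" and "m' = pell u (k - 2) div u"
  obtain h where k: "k = 2 * Suc h" and "h \<ge> 1"
    using \<open>even k\<close> \<open>4 \<le> k\<close> by (auto elim!: evenE intro: that[of "k div 2 - 1"])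
  have um: "u * m = pell u k" and um': "u * m' = pell u (2 * h)"
    using dvd_pell_even[of u "Suc h"] dvd_pell_even[of u h]
    unfolding m_def m'_def k by (simp_all only: dvd_mult_div_cancel mult_Suc_right diff_add_inverse)
  have "pell u 1 \<le> pell u (2 * h)"
    using \<open>u > 0\<close> \<open>h \<ge> 1\<close> by (intro pell_mono) auto
  then have m'_pos: "m' > 0"
    using um' by (cases m') auto
  have "u * (2 * m') \<le> u * m"
    using pell_double_le[OF \<open>u > 0\<close>, of "2 * h"] um um' k by simp
  then have m'_m: "2 * m' \<le> m"
    using \<open>u > 0\<close> by simp
  have "m \<le> u * m"
    using \<open>u > 0\<close> by simp
  also have "u * m \<le> a"
    unfolding um a_def using \<open>u > 0\<close> \<open>k \<le> 2 * i\<close> by (intro pell_mono) auto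
  finally have "m \<le> a" .
  have "m > 0"
    using m'_pos m'_m by simp
  have q: "q = a div m"
    unfolding q_def um[symmetric] a_def using \<open>u > 0\<close> by simp
  \<comment> \<open>The integer \<open>r\<close> of the statement is this natural remainder.\<close>
  define r' where "r' = a mod m"
  have a_eq: "a = q * m + r'"
    by (simp add: q r'_def)
  have r: "r = int r'"
    using arg_cong[OF a_eq, of int] unfolding r_def a_def[symmetric] m_def[symmetric] by simp
  have ab: "2 * a \<le> b"
    using pell_double_le[OF \<open>u > 0\<close>, of "2 * i + 1"] by (simp add: a_def b_def numeral_eq_Suc)
  have "2 * i + 1 + 2 * Suc h = 2 * i + k + 1" "2 * i + 1 + 2 = 2 * i + 3"
    using k by simp_all
  then have "u * c + (u * m') * a = (u * m) * b"
    using pell_even_shift[of u "2 * i + 1" h] k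
    unfolding um um' a_def b_def c_def by (simp only:)
  then have "u * (m * b) = u * (c + m' * a)"
    by (simp add: distrib_left mult.assoc)
  then have c_eq: "m * b = c + m' * a"
    using \<open>u > 0\<close> by simp
  have "(2 * m') * (2 * a) \<le> m * b"
    using m'_m ab by (rule mult_le_mono)
  then have m'_a: "m' * a \<le> c"
    using c_eq by (simp add: ac_simps)

  \<comment> \<open>Expanding \<open>b\<close> as \<open>(u^2 + 1) a + u P\<close> with
    \<open>P = pell u (2 * i)\<close> turns the case condition into
    \<open>m' a < r' b\<close>.\<close>
  have b_eq: "b = u * (u * a + pell u (2 * i)) + a"
    by (simp add: a_def b_def numeral_3_eq_3)
  have "int u * r * int (pell u (2 * i)) - (int m' - (int u ^ 2 + 1) * r) * int a
      = int (r' * b) - int (m' * a)"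
    unfolding r b_eq by (simp add: power2_eq_square algebra_simps)
  then have cond: "(int m' - (int u ^ 2 + 1) * r) * int a < int u * r * int (pell u (2 * i))
      \<longleftrightarrow> m' * a < r' * b"
    by linarith

  interpret L_shape a b c m m' q r'
  proof
    show "a > 0"
      using \<open>m \<le> a\<close> \<open>m > 0\<close> by simp
    then show "a < b"
      using ab by simp
    show "coprime a b"
    proof -
      have "coprime a (u * pell u (Suc (2 * i + 1)))"
        using coprime_pell_odd[of u i] coprime_pell_Suc[of u "2 * i + 1"]
        unfolding a_def[symmetric] by (simp only: coprime_mult_right_iff coprime_commute[of a u])
      moreover have "b = u * pell u (Suc (2 * i + 1)) + a"
        by (simp add: a_def b_def numeral_3_eq_3)
      ultimately show ?thesis
        by (simp only: coprime_iff_gcd_eq_1 gcd_add1 gcd.commute[of a])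
    qed
    have "2 * b \<le> m * b"
      using m'_m m'_pos by simp
    moreover have "4 * (m' * a) \<le> m * b"
      using \<open>(2 * m') * (2 * a) \<le> m * b\<close> by simp
    ultimately show "b < c"
      using c_eq \<open>a < b\<close> by linarith
    show "m \<ge> 2"
      using m'_m m'_pos by simp
    show "0 < q"
      using \<open>m \<le> a\<close> \<open>m > 0\<close> by (simp add: q div_greater_zero_iff)
    \<comment> \<open>Doubling allows \<open>2 m' \<le> m\<close>; then
      \<open>(q + 1) m \<le> a + m \<le> 2 a\<close>.\<close>
    have "(q + 1) * (2 * m') \<le> (q + 1) * m"
      using m'_m by (rule mult_le_mono2)
    also have "\<dots> \<le> 2 * a"
      using \<open>m \<le> a\<close> a_eq unfolding distrib_right by linarith
    finally show "(q + 1) * m' \<le> b"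
      using ab by simp
    show "r' < m"
      using \<open>m > 0\<close> by (simp add: r'_def)
  qed (fact c_eq a_eq m'_a)+
  show ?thesis
    unfolding a_def[symmetric] b_def[symmetric] c_def[symmetric] m_def[symmetric] m'_def[symmetric] cond
    unfolding r by (rule p_frobenius_L_shape) fact
qed

end
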